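(* Let $k\ge 2$ and let $n$ be a positive integer divisible by $k$. Then every tournament on $n$ players with $H=K_k$ that cannot be extended has at least $\left\lfloor \frac{n}{k(k-1)}\right\rfloor$ rounds. Equivalently, the greedy algorithm (starting from the empty tournament and repeatedly appending an arbitrary $K_k$-factor of the current feasibility graph until none exists) always outputs a tournament with at least $\left\lfloor \frac{n}{k(k-1)}\right\rfloor$ rounds.
   Context: For a graph $H$ and $n\ge 2$, an $H$-factor of a graph on $n$ vertices is a union of vertex-disjoint copies of $H$ covering every vertex; a $K_k$-factor of $K_n$ is thus a partition of the vertex set into $n/k$ sets of size $k$, each spanning a complete graph. A tournament with $r$ rounds on $n$ players with $H$ is a tuple $(H_1,\dots,H_r)$ of $H$-factors of the complete graph $K_n$ such that each edge of $K_n$ lies in at most one $H_i$. The feasibility graph is $G=K_n\setminus\bigcup_{i\le r}H_i$. The tournament can be extended if $G$ contains an $H$-factor $H_{r+1}$, so that $(H_1,\dots,H_{r+1})$ is again a tournament. *)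

theory Defs
  imports Complex_Main
begin

datatype 'a graph = Graph (verts: "'a set") (edges: "'a set set")

definition complete_graph :: "'a set \<Rightarrow> 'a graph" where
  "complete_graph V = Graph V {e. e \<subseteq> V \<and> card e = 2}"

definition subgraph :: "'a graph \<Rightarrow> 'a graph \<Rightarrow> bool" where
  "subgraph C G \<longleftrightarrow> verts C \<subseteq> verts G \<and> edges C \<subseteq> edges G"

definition isomorphic :: "'a graph \<Rightarrow> 'b graph \<Rightarrow> bool" where
  "isomorphic H C \<longleftrightarrow>
     (\<exists>f. bij_betw f (verts H) (verts C) \<and> edges C = (\<lambda>e. f ` e) ` edges H)"

definition graph_Union :: "'a graph set \<Rightarrow> 'a graph" where
  "graph_Union \<C> = Graph (\<Union>C\<in>\<C>. verts C) (\<Union>C\<in>\<C>. edges C)"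

text \<open>A factor is the spanning subgraph itself, not the family of copies of \<open>H\<close> it
  is made of; copies need not be induced subgraphs of \<open>G\<close>.\<close>

definition is_factor :: "'b graph \<Rightarrow> 'a graph \<Rightarrow> 'a graph \<Rightarrow> bool" where
  "is_factor H G F \<longleftrightarrow>
     (\<exists>\<C>. (\<forall>C\<in>\<C>. subgraph C G \<and> isomorphic H C) \<and>
          pairwise (\<lambda>C D. disjnt (verts C) (verts D)) \<C> \<and>
          F = graph_Union \<C> \<and> verts F = verts G)"

definition tournament :: "'b graph \<Rightarrow> 'a set \<Rightarrow> 'a graph list \<Rightarrow> bool" where
  "tournament H V Hs \<longleftrightarrow>
     (\<forall>F\<in>set Hs. is_factor H (complete_graph V) F) \<and>
     (\<forall>e\<in>edges (complete_graph V). \<forall>i<length Hs. \<forall>j<length Hs.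
        e \<in> edges (Hs ! i) \<and> e \<in> edges (Hs ! j) \<longrightarrow> i = j)"

definition feasibility_graph :: "'a set \<Rightarrow> 'a graph list \<Rightarrow> 'a graph" where
  "feasibility_graph V Hs = Graph V (edges (complete_graph V) - (\<Union>F\<in>set Hs. edges F))"

definition extendable :: "'b graph \<Rightarrow> 'a set \<Rightarrow> 'a graph list \<Rightarrow> bool" where
  "extendable H V Hs \<longleftrightarrow> (\<exists>F. is_factor H (feasibility_graph V Hs) F)"

lemma tournament_append:
  assumes "tournament H V Hs" "is_factor H (feasibility_graph V Hs) F"
  shows "tournament H V (Hs @ [F])"
proof -
  obtain \<C> where \<C>: "\<And>C. C \<in> \<C> \<Longrightarrow> subgraph C (feasibility_graph V Hs) \<and> isomorphic H C"
    "pairwise (\<lambda>C D. disjnt (verts C) (verts D)) \<C>" "F = graph_Union \<C>" "verts F = V"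
    using assms(2) by (auto simp: is_factor_def feasibility_graph_def)
  have "\<forall>C\<in>\<C>. subgraph C (complete_graph V) \<and> isomorphic H C"
    using \<C>(1) by (auto simp: subgraph_def feasibility_graph_def complete_graph_def)
  then have F: "is_factor H (complete_graph V) F"
    unfolding is_factor_def using \<C>(2-4) by (intro exI[of _ \<C>]) (simp add: complete_graph_def)
  have new: "e \<notin> edges (Hs ! i)" if "e \<in> edges F" "i < length Hs" for e i
  proof -
    from that(1) obtain C where "C \<in> \<C>" "e \<in> edges C"
      unfolding \<C>(3) by (auto simp: graph_Union_def)
    then have "e \<in> edges (feasibility_graph V Hs)"
      using \<C>(1) by (auto simp: subgraph_def)
    then show ?thesis
      using that(2) by (auto simp: feasibility_graph_def)
  qed
  show ?thesis
    unfolding tournament_def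
  proof (intro conjI ballI allI impI)
    fix G assume "G \<in> set (Hs @ [F])"
    then show "is_factor H (complete_graph V) G"
      using assms(1) F by (auto simp: tournament_def)
  next
    fix e i j
    assume *: "e \<in> edges (complete_graph V)" "i < length (Hs @ [F])" "j < length (Hs @ [F])"
      "e \<in> edges ((Hs @ [F]) ! i) \<and> e \<in> edges ((Hs @ [F]) ! j)"
    show "i = j"
    proof (cases "i < length Hs \<and> j < length Hs")
      case True
      then show ?thesis
        using * assms(1) unfolding tournament_def by (simp add: nth_append)
    next
      case False
      then show ?thesis
        using * new[of e i] new[of e j] by (auto simp: nth_append split: if_splits)
    qed
  qed
qed

definition greedy_step :: "'b graph \<Rightarrow> 'a set \<Rightarrow> 'a graph list \<Rightarrow> 'a graph list \<Rightarrow> bool" where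
  "greedy_step H V Hs Hs' \<longleftrightarrow>
     (\<exists>F. is_factor H (feasibility_graph V Hs) F \<and> Hs' = Hs @ [F])"

definition greedy_output :: "'b graph \<Rightarrow> 'a set \<Rightarrow> 'a graph list \<Rightarrow> bool" where
  "greedy_output H V Hs \<longleftrightarrow>
     (greedy_step H V)\<^sup>*\<^sup>* [] Hs \<and> \<not> (\<exists>Hs'. greedy_step H V Hs Hs')"

definition greedy_terminates :: "'b graph \<Rightarrow> 'a set \<Rightarrow> bool" where
  "greedy_terminates H V \<longleftrightarrow>
     \<not> (\<exists>S :: nat \<Rightarrow> 'a graph list. S 0 = [] \<and> (\<forall>i. greedy_step H V (S i) (S (Suc i))))"

end

(* In the graph of pairs that have already met every vertex has degree at most r(k-1) after r rounds.
   If r < floor(n / (k(k-1))), this is less than n/k, so by the Hajnal-Szemeredi theorem the graph has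
   a proper colouring with n/k colours whose classes all have size k. These classes form a K_k-factor
   of the feasibility graph, and the tournament can be extended.

   The Hajnal-Szemeredi theorem is proved following Kierstead and Kostochka (2008), by induction on the
   number of edges. Removing the edges at one vertex and recolouring it yields a proper colouring in
   which only one class p is too large and one class m too small, each by one vertex. A class is
   accessible if it reaches m by successive single-vertex moves; if p is accessible, shifting one vertex
   along each edge of a path repairs the colouring. Otherwise a weighting argument finds a vertex z of
   an accessible class W and a vertex y outside the accessible classes, z being the only
   neighbour of y in W, such that y can replace z in W and z can go elsewhere; the remaining
   inaccessible vertices are recoloured by induction. The result can be repaired, or it has more
   accessible classes than before. *)

theory Submission
  imports Defs "HOL-Library.Transitive_Closure_Table"
begin

subsection \<open>Colourings and moves of single vertices\<close>

text \<open>\<open>E\<close> is not restricted to \<open>S\<close>: an induced subgraph is given by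
  its vertex set alone, so the induction can pass to smaller vertex sets with the same
  relation.\<close>

definition deg :: "('a \<Rightarrow> 'a \<Rightarrow> bool) \<Rightarrow> 'a set \<Rightarrow> 'a \<Rightarrow> nat" where
  "deg E S v = card {w\<in>S. E v w}"

definition colour_class :: "'a set \<Rightarrow> ('a \<Rightarrow> 'c) \<Rightarrow> 'c \<Rightarrow> 'a set" where
  "colour_class V f i = {v\<in>V. f v = i}"

definition colouring :: "'a set \<Rightarrow> ('a \<Rightarrow> 'a \<Rightarrow> bool) \<Rightarrow> 'c set \<Rightarrow> ('a \<Rightarrow> 'c) \<Rightarrow> bool" where
  "colouring V E C f \<longleftrightarrow> f ` V \<subseteq> C \<and> (\<forall>x\<in>V. \<forall>y\<in>V. E x y \<longrightarrow> f x \<noteq> f y)"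

definition equitable :: "'a set \<Rightarrow> ('a \<Rightarrow> 'a \<Rightarrow> bool) \<Rightarrow> 'c set \<Rightarrow> nat \<Rightarrow> ('a \<Rightarrow> 'c) \<Rightarrow> bool" where
  "equitable V E C s f \<longleftrightarrow> colouring V E C f \<and> (\<forall>i\<in>C. card (colour_class V f i) = s)"

text \<open>Class \<open>p\<close> has one vertex too many and class \<open>m\<close> one too few; for \<open>p = m\<close> the two defects
  cancel and the colouring is equitable.\<close>

definition nearly_equitable ::
    "'a set \<Rightarrow> ('a \<Rightarrow> 'a \<Rightarrow> bool) \<Rightarrow> 'c set \<Rightarrow> nat \<Rightarrow> ('a \<Rightarrow> 'c) \<Rightarrow> 'c \<Rightarrow> 'c \<Rightarrow> bool" where
  "nearly_equitable V E C s f p m \<longleftrightarrow> colouring V E C f \<and> p \<in> C \<and> m \<in> C \<and>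
     (\<forall>i\<in>C. card (colour_class V f i) + of_bool (i = m) = s + of_bool (i = p))"

text \<open>The own class of \<open>v\<close> is excluded: in a proper colouring it contains no
  neighbour of \<open>v\<close> and would always qualify.\<close>

definition movable :: "'a set \<Rightarrow> ('a \<Rightarrow> 'a \<Rightarrow> bool) \<Rightarrow> ('a \<Rightarrow> 'c) \<Rightarrow> 'a \<Rightarrow> 'c \<Rightarrow> bool" where
  "movable V E f v j \<longleftrightarrow> j \<noteq> f v \<and> (\<forall>w\<in>V. f w = j \<longrightarrow> \<not> E v w)"

text \<open>The auxiliary digraph on the colour classes, with an edge wherever a single vertex can
  move.\<close>

definition shifts :: "'a set \<Rightarrow> ('a \<Rightarrow> 'a \<Rightarrow> bool) \<Rightarrow> 'c set \<Rightarrow> ('a \<Rightarrow> 'c) \<Rightarrow> 'c \<Rightarrow> 'c \<Rightarrow> bool" where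
  "shifts V E C f i j \<longleftrightarrow> i \<in> C \<and> j \<in> C \<and> (\<exists>v\<in>V. f v = i \<and> movable V E f v j)"

section \<open>Degrees, class sizes and single recolourings\<close>

lemma deg_conv_sum: "finite S \<Longrightarrow> deg E S v = (\<Sum>w\<in>S. of_bool (E v w))"
  by (simp add: deg_def Int_def)

lemma sum_deg_commute:
  assumes "finite S" "finite T" "symp E"
  shows "(\<Sum>x\<in>S. deg E T x) = (\<Sum>y\<in>T. deg E S y)"
proof -
  have "(\<Sum>x\<in>S. deg E T x) = (\<Sum>x\<in>S. \<Sum>y\<in>T. of_bool (E x y))"
    using assms by (simp add: deg_conv_sum)
  also have "\<dots> = (\<Sum>y\<in>T. \<Sum>x\<in>S. of_bool (E x y))"
    by (rule sum.swap)
  also have "\<dots> = (\<Sum>y\<in>T. \<Sum>x\<in>S. of_bool (E y x))"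
    using assms(3) by (intro sum.cong refl) (auto dest: sympD)
  also have "\<dots> = (\<Sum>y\<in>T. deg E S y)"
    using assms by (simp add: deg_conv_sum)
  finally show ?thesis .
qed

lemma deg_mono: "finite T \<Longrightarrow> S \<subseteq> T \<Longrightarrow> deg E S v \<le> deg E T v"
  unfolding deg_def by (rule card_mono) auto

lemma card_union_classes:
  assumes "finite V" "finite D"
  shows "card {v\<in>V. f v \<in> D} = (\<Sum>i\<in>D. card (colour_class V f i))"
proof -
  have "{v\<in>V. f v \<in> D} = (\<Union>i\<in>D. colour_class V f i)"
    by (auto simp: colour_class_def)
  also have "card \<dots> = (\<Sum>i\<in>D. card (colour_class V f i))"
    using assms by (intro card_UN_disjoint) (auto simp: colour_class_def)
  finally show ?thesis .
qed

lemma deg_union_classes: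
  assumes "finite V" "finite D"
  shows "deg E {v\<in>V. f v \<in> D} x = (\<Sum>i\<in>D. deg E (colour_class V f i) x)"
proof -
  have "{w \<in> {v\<in>V. f v \<in> D}. E x w} = {w \<in> {w\<in>V. E x w}. f w \<in> D}"
    "\<And>i. {w \<in> colour_class V f i. E x w} = colour_class {w\<in>V. E x w} f i"
    by (auto simp: colour_class_def)
  then show ?thesis
    unfolding deg_def using assms card_union_classes[of "{w\<in>V. E x w}" D f] by simp
qed

lemma deg_class_pos_iff:
  assumes "finite V"
  shows "1 \<le> deg E (colour_class V f j) v \<longleftrightarrow> (\<exists>w\<in>V. f w = j \<and> E v w)"
proof -
  have "finite {w \<in> colour_class V f j. E v w}"
    using assms by (simp add: colour_class_def)
  then have "1 \<le> deg E (colour_class V f j) v \<longleftrightarrow> {w \<in> colour_class V f j. E v w} \<noteq> {}"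
    unfolding deg_def by (simp add: card_gt_0_iff Suc_le_eq)
  then show ?thesis
    by (auto simp: colour_class_def)
qed

text \<open>Pigeonhole: under any \<open>f\<close>, the neighbours of \<open>v\<close> in
  \<open>S\<close> carry fewer than \<open>card D\<close> values.\<close>

lemma free_colour:
  assumes "finite S" "finite D" "deg E S v < card D"
  obtains j where "j \<in> D" "\<And>w. w \<in> S \<Longrightarrow> f w = j \<Longrightarrow> \<not> E v w"
proof -
  have "card (f ` {w\<in>S. E v w}) < card D"
    using assms card_image_le[of "{w\<in>S. E v w}" f] by (simp add: deg_def)
  then have "\<not> D \<subseteq> f ` {w\<in>S. E v w}"
    using assms(1) card_mono[of "f ` {w\<in>S. E v w}" D] by auto
  then show thesis
    using that by blast
qed

text \<open>The indicators stand on opposite sides to avoid subtraction of naturals; for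
  \<open>j = f v\<close> they agree and nothing changes.\<close>

lemma card_class_upd:
  assumes "finite V" "v \<in> V"
  shows "card (colour_class V (f(v := j)) i) + of_bool (i = f v)
       = card (colour_class V f i) + of_bool (i = j)"
proof (cases "j = f v")
  case False
  have eq: "colour_class V (f(v := j)) i =
      (if i = j then insert v (colour_class V f i) else colour_class V f i - {v})"
    using assms False by (auto simp: colour_class_def)
  have fin: "finite (colour_class V f i)"
    using assms by (simp add: colour_class_def)
  consider "i = j" | "i = f v" | "i \<noteq> j" "i \<noteq> f v" by blast
  then show ?thesis
  proof cases
    case 1
    then have "v \<notin> colour_class V f i"
      using False by (simp add: colour_class_def)
    then show ?thesis
      using 1 False assms fin unfolding eq by simp
  next
    case 2
    then have "v \<in> colour_class V f i"
      using assms by (simp add: colour_class_def)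
    then have "Suc (card (colour_class V f i - {v})) = card (colour_class V f i)"
      using fin by (meson card_Suc_Diff1)
    then show ?thesis
      using 2 False assms unfolding eq by auto
  next
    case 3
    then have "v \<notin> colour_class V f i"
      by (simp add: colour_class_def)
    then show ?thesis
      using 3 unfolding eq by simp
  qed
qed simp

lemma colouring_upd:
  assumes "colouring V E C f" "symp E" "irreflp E" "j \<in> C" "movable V E f v j"
  shows "colouring V E C (f(v := j))"
  using assms unfolding colouring_def movable_def
  by (auto simp: irreflp_def dest: sympD)

text \<open>The surplus travels with the moved vertex while the deficit stays at \<open>m\<close>; a
  move into \<open>m\<close> therefore ends the repair.\<close>

lemma nearly_equitable_upd:
  assumes "nearly_equitable V E C s f p m" "finite V" "symp E" "irreflp E"
    "v \<in> V" "f v = p" "j \<in> C" "movable V E f v j"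
  shows "nearly_equitable V E C s (f(v := j)) j m"
proof -
  have "card (colour_class V (f(v := j)) i) + of_bool (i = m) = s + of_bool (i = j)"
    if "i \<in> C" for i
  proof -
    have "card (colour_class V f i) + of_bool (i = m) = s + of_bool (i = p)"
      using assms(1) that by (simp add: nearly_equitable_def)
    moreover have "card (colour_class V (f(v := j)) i) + of_bool (i = p)
        = card (colour_class V f i) + of_bool (i = j)"
      using card_class_upd[of V v f j i] assms by simp
    ultimately show ?thesis by linarith
  qed
  then show ?thesis
    using assms colouring_upd[of V E C f j v] by (simp add: nearly_equitable_def)
qed

lemma nearly_equitable_refl:
  "nearly_equitable V E C s f m m \<Longrightarrow> equitable V E C s f"
  by (auto simp: nearly_equitable_def equitable_def)

text \<open>Only the classes in \<open>xs\<close> are needed as targets. On a distinct path this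
  spares the moves into the first class, which may become illegal once that class has received a new
  vertex.\<close>

lemma rtrancl_path_mono_targets:
  assumes "rtrancl_path R x xs y" "\<And>i j. R i j \<Longrightarrow> i \<in> set (x # xs) \<Longrightarrow> j \<in> set xs \<Longrightarrow> R' i j"
  shows "rtrancl_path R' x xs y"
  using assms
proof (induction rule: rtrancl_path.induct)
  case (base x)
  show ?case by (rule rtrancl_path.base)
next
  case (step x y ys z)
  from step.prems have "rtrancl_path R' y ys z"
    by (intro step.IH) simp
  then show ?case
    using step by (intro rtrancl_path.step) auto
qed

text \<open>The vertices are moved one class further along the path, starting at the oversized class;
  distinctness of the path keeps the remaining moves legal.\<close>

lemma equitable_if_path:
  assumes "rtrancl_path (shifts V E C f) p xs m" "distinct (p # xs)"
    "nearly_equitable V E C s f p m" "finite V" "symp E" "irreflp E"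
  shows "\<exists>g. equitable V E C s g"
  using assms
proof (induction xs arbitrary: p f)
  case Nil
  then have "p = m"
    by (auto elim: rtrancl_path.cases)
  then show ?case
    using Nil.prems(3) nearly_equitable_refl by metis
next
  case (Cons j xs)
  from Cons.prems(1) have j: "shifts V E C f p j" "rtrancl_path (shifts V E C f) j xs m"
    by (auto elim: rtrancl_path.cases)
  then obtain v where v: "v \<in> V" "f v = p" "movable V E f v j" "j \<in> C"
    by (auto simp: shifts_def)
  have "shifts V E C (f(v := j)) a b"
    if "shifts V E C f a b" "a \<in> set (j # xs)" "b \<in> set xs" for a b
  proof -
    \<comment> \<open>The vertex witnessing \<open>shifts V E C f a b\<close> is not
      \<open>v\<close>, because \<open>a \<noteq> p\<close>; the target class has not received
      \<open>v\<close>, because \<open>b \<noteq> j\<close>.\<close>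
    have "a \<noteq> p" "b \<noteq> p" "b \<noteq> j"
      using that Cons.prems(2) by auto
    then show ?thesis
      using that(1) v unfolding shifts_def movable_def by (metis fun_upd_apply)
  qed
  then have "rtrancl_path (shifts V E C (f(v := j))) j xs m"
    using rtrancl_path_mono_targets[OF j(2)] by blast
  moreover have "nearly_equitable V E C s (f(v := j)) j m"
    using nearly_equitable_upd Cons.prems v by metis
  moreover have "distinct (j # xs)"
    using Cons.prems(2) by simp
  ultimately show ?case
    using Cons.IH Cons.prems(4-6) by blast
qed

lemma equitable_if_reachable:
  assumes "(shifts V E C f)\<^sup>*\<^sup>* p m" "nearly_equitable V E C s f p m" "finite V" "symp E" "irreflp E"
  shows "\<exists>g. equitable V E C s g"
proof -
  obtain xs where "rtrancl_path (shifts V E C f) p xs m"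
    using assms(1) by (auto simp: rtranclp_eq_rtrancl_path)
  then obtain ys where "rtrancl_path (shifts V E C f) p ys m" "distinct (p # ys)"
    by (rule rtrancl_path_distinct)
  then show ?thesis
    using equitable_if_path assms by metis
qed

subsection \<open>Accessible classes and solo edges\<close>

locale stuck_colouring =
  fixes V :: "'a set" and E :: "'a \<Rightarrow> 'a \<Rightarrow> bool" and C :: "'c set" and s :: nat
    and f :: "'a \<Rightarrow> 'c" and p m :: 'c
  assumes finite_V: "finite V" and finite_C: "finite C"
    and sym: "symp E" and irrefl: "irreflp E"
    and degree: "\<And>v. v \<in> V \<Longrightarrow> deg E V v < card C"
    and near: "nearly_equitable V E C s f p m"
    and stuck: "\<not> (shifts V E C f)\<^sup>*\<^sup>* p m"
begin

abbreviation sh :: "'c \<Rightarrow> 'c \<Rightarrow> bool" where "sh \<equiv> shifts V E C f"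

abbreviation cls :: "'c \<Rightarrow> 'a set" where "cls \<equiv> colour_class V f"

definition acc :: "'c set" where "acc = {i\<in>C. sh\<^sup>*\<^sup>* i m}"

definition B :: "'a set" where "B = {v\<in>V. f v \<in> C - acc}"

definition q :: nat where "q = card (C - acc)"

definition avoid :: "'c \<Rightarrow> 'c \<Rightarrow> 'c \<Rightarrow> bool" where
  "avoid U i j \<longleftrightarrow> sh i j \<and> i \<in> acc - {U} \<and> j \<in> acc - {U}"

text \<open>The accessible classes all of whose routes to \<open>m\<close> pass through
  \<open>U\<close>. A class other than \<open>m\<close> that blocks nothing is usually called
  terminal.\<close>

definition blocked :: "'c \<Rightarrow> 'c set" where
  "blocked U = {i\<in>acc - {U}. \<not> (avoid U)\<^sup>*\<^sup>* i m}"

text \<open>Used with \<open>y \<in> B\<close> and \<open>f z \<in> acc\<close>: then \<open>z\<close> is the only neighbour of \<open>y\<close> in its class.\<close>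

definition solo :: "'a \<Rightarrow> 'a \<Rightarrow> bool" where
  "solo z y \<longleftrightarrow> E z y \<and> deg E (cls (f z)) y = 1"

lemma colours: "v \<in> V \<Longrightarrow> f v \<in> C"
  using near by (auto simp: nearly_equitable_def colouring_def)

lemma acc_subset: "acc \<subseteq> C"
  by (auto simp: acc_def)

lemma sh_acc: "sh i j \<Longrightarrow> j \<in> acc \<Longrightarrow> i \<in> acc"
  using converse_rtranclp_into_rtranclp[of sh i j m] by (simp add: acc_def) (simp add: shifts_def)

lemma finite_acc: "finite acc"
  using finite_C acc_subset finite_subset by blast

lemma finite_B: "finite B"
  using finite_V by (simp add: B_def)

lemma finite_blocked: "finite (blocked U)"
  using finite_acc by (simp add: blocked_def)

lemma finite_cls: "finite (cls i)"
  using finite_V by (simp add: colour_class_def)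

lemma m_acc: "m \<in> acc"
  using near by (simp add: acc_def nearly_equitable_def)

lemma p_not_acc: "p \<in> C - acc"
  using near stuck by (simp add: acc_def nearly_equitable_def)

lemma q_pos: "0 < q"
  using p_not_acc finite_C by (auto simp: q_def card_gt_0_iff)

lemma card_C: "card C = card acc + q"
  using acc_subset finite_C by (simp add: q_def card_Diff_subset card_mono finite_acc)

lemma card_cls: "i \<in> C \<Longrightarrow> card (cls i) + of_bool (i = m) = s + of_bool (i = p)"
  using near by (simp add: nearly_equitable_def)

lemma card_cls_acc: "i \<in> acc \<Longrightarrow> i \<noteq> m \<Longrightarrow> card (cls i) = s"
  using card_cls[of i] p_not_acc acc_subset by auto

lemma card_cls_m: "Suc (card (cls m)) = s"
  using card_cls[of m] m_acc p_not_acc acc_subset by auto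

lemma card_B: "card B = q * s + 1"
proof -
  have "card B = (\<Sum>i\<in>C - acc. card (cls i))"
    unfolding B_def using finite_V finite_C by (intro card_union_classes) auto
  also have "\<dots> = (\<Sum>i\<in>C - acc. s + of_bool (i = p))"
  proof (intro sum.cong refl)
    fix i assume "i \<in> C - acc"
    then show "card (cls i) = s + of_bool (i = p)"
      using card_cls[of i] m_acc by (cases "i = m") auto
  qed
  also have "\<dots> = q * s + (\<Sum>i\<in>C - acc. of_bool (i = p))"
    by (simp add: sum.distrib q_def)
  also have "(\<Sum>i\<in>C - acc. of_bool (i = p)) = (1::nat)"
    using p_not_acc finite_C by (simp add: of_bool_def)
  finally show ?thesis .
qed

text \<open>The neighbours of \<open>x\<close> are counted class by class; the classes outside
  \<open>acc\<close> together form \<open>B\<close>. The degree bounds below rest on this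
  inequality.\<close>

lemma deg_split:
  assumes "x \<in> V"
  shows "(\<Sum>i\<in>acc. deg E (cls i) x) + deg E B x < card acc + q"
proof -
  have "V = {v\<in>V. f v \<in> C}"
    using colours by auto
  then have "deg E V x = (\<Sum>i\<in>C. deg E (cls i) x)"
    using deg_union_classes[OF finite_V finite_C, of E f x] by simp
  also have "\<dots> = (\<Sum>i\<in>acc. deg E (cls i) x) + (\<Sum>i\<in>C - acc. deg E (cls i) x)"
    using sum.subset_diff[OF acc_subset finite_C] by (metis add.commute)
  also have "(\<Sum>i\<in>C - acc. deg E (cls i) x) = deg E B x"
    unfolding B_def using finite_V finite_C by (intro deg_union_classes[symmetric]) auto
  finally show ?thesis
    using degree[OF assms] card_C by simp
qed

lemma deg_B_less:
  assumes "x \<in> V" "D \<subseteq> acc" "\<And>i. i \<in> D \<Longrightarrow> 1 \<le> deg E (cls i) x"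
  shows "card D + deg E B x < card acc + q"
proof -
  have "card D \<le> (\<Sum>i\<in>D. deg E (cls i) x)"
    using sum_mono[of D "\<lambda>_. 1" "\<lambda>i. deg E (cls i) x"] assms(3) by simp
  also have "\<dots> \<le> (\<Sum>i\<in>acc. deg E (cls i) x)"
    using assms(2) finite_acc by (intro sum_mono2) auto
  finally show ?thesis
    using deg_split[OF assms(1)] by linarith
qed

lemma deg_cls_pos:
  assumes "j \<noteq> f x" "\<not> movable V E f x j"
  shows "1 \<le> deg E (cls j) x"
  using assms unfolding deg_class_pos_iff[OF finite_V] movable_def by auto

text \<open>Otherwise \<open>y\<close> could move to \<open>i\<close>, and its own class would be
  accessible.\<close>

lemma B_deg_cls_pos:
  assumes "y \<in> B" "i \<in> acc"
  shows "1 \<le> deg E (cls i) y"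
proof (rule deg_cls_pos)
  have y: "y \<in> V" "f y \<in> C" "f y \<notin> acc"
    using assms by (auto simp: B_def)
  then show "i \<noteq> f y"
    using assms by auto
  show "\<not> movable V E f y i"
    using y assms sh_acc[of "f y" i] acc_subset by (auto simp: shifts_def)
qed

text \<open>This is the degree hypothesis for colouring what remains of \<open>B\<close> with the
  \<open>q\<close> inaccessible colours.\<close>

lemma deg_B_B: "y \<in> B \<Longrightarrow> deg E B y < q"
  using deg_B_less[of y acc] B_deg_cls_pos by (auto simp: B_def)

lemma m_not_blocked: "m \<notin> blocked U"
  by (simp add: blocked_def)

text \<open>Double counting: each of the \<open>q * s + 1\<close> vertices of \<open>B\<close> has a
  neighbour in \<open>cls m\<close>, but the \<open>s - 1\<close> vertices of \<open>cls m\<close>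
  would have at most \<open>q\<close> neighbours each in \<open>B\<close>.\<close>

lemma acc_not_singleton: "acc \<noteq> {m}"
proof
  assume acc: "acc = {m}"
  have "card B \<le> (\<Sum>y\<in>B. deg E (cls m) y)"
    using sum_mono[of B "\<lambda>_. 1" "deg E (cls m)"] B_deg_cls_pos m_acc by simp
  also have "\<dots> = (\<Sum>x\<in>cls m. deg E B x)"
    by (rule sum_deg_commute[OF finite_B finite_cls sym])
  also have "\<dots> \<le> (\<Sum>x\<in>cls m. q)"
  proof (rule sum_mono)
    fix x assume "x \<in> cls m"
    then show "deg E B x \<le> q"
      using deg_split[of x] acc by (simp add: colour_class_def)
  qed
  also have "\<dots> \<le> q * s"
    using card_cls_m by (simp add: mult.commute)
  finally show False
    using card_B by simp
qed

section \<open>Accessible classes cut off by another class\<close>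

lemma avoid_from_self: "(avoid U)\<^sup>*\<^sup>* U j \<Longrightarrow> j = U"
  by (erule converse_rtranclpE) (auto simp: avoid_def)

lemma avoid_acc: "(avoid U)\<^sup>*\<^sup>* i m \<Longrightarrow> i \<in> acc"
  by (erule converse_rtranclpE) (auto simp: avoid_def m_acc)

text \<open>Look at the last visit to \<open>U\<close> on a walk from \<open>i\<close> to
  \<open>m\<close>: after it the walk avoids \<open>U\<close>.\<close>

lemma reachable_cases:
  assumes "sh\<^sup>*\<^sup>* i m"
  shows "(avoid U)\<^sup>*\<^sup>* i m \<or> U = m \<or> (\<exists>j. sh U j \<and> (avoid U)\<^sup>*\<^sup>* j m)"
  using assms
proof (induction rule: converse_rtranclp_induct)
  case base
  then show ?case by blast
next
  case (step i j)
  then consider "(avoid U)\<^sup>*\<^sup>* j m" | "U = m" | "\<exists>j. sh U j \<and> (avoid U)\<^sup>*\<^sup>* j m"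
    by blast
  then show ?case
  proof cases
    case 1
    have "i \<in> acc" "j \<in> acc"
      using sh_acc[OF step(1)] avoid_acc[OF 1] by auto
    then consider "i = U" | "j = U" | "avoid U i j"
      using step(1) by (auto simp: avoid_def)
    then show ?thesis
    proof cases
      case 2
      then show ?thesis
        using 1 avoid_from_self by blast
    qed (use 1 step(1) in \<open>auto intro: converse_rtranclp_into_rtranclp\<close>)
  qed auto
qed

lemma blocked_m: "blocked m = acc - {m}"
proof -
  have "i = m" if "(avoid m)\<^sup>*\<^sup>* i m" for i
    using that by (cases rule: rtranclp.cases) (auto simp: avoid_def)
  then show ?thesis
    by (auto simp: blocked_def)
qed

text \<open>Every class on a path avoiding \<open>U\<close> reaches \<open>m\<close> without
  \<open>U\<close>, so the path cannot meet \<open>W\<close>.\<close>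

lemma avoid_blocked:
  assumes "(avoid U)\<^sup>*\<^sup>* i m" "W \<in> blocked U"
  shows "(avoid W)\<^sup>*\<^sup>* i m"
  using assms(1)
proof (induction rule: converse_rtranclp_induct)
  case base
  then show ?case by simp
next
  case (step i j)
  have "(avoid U)\<^sup>*\<^sup>* i m"
    using step by (auto intro: converse_rtranclp_into_rtranclp)
  then have "i \<noteq> W" "j \<noteq> W"
    using step assms(2) by (auto simp: blocked_def)
  then have "avoid W i j"
    using step by (auto simp: avoid_def)
  then show ?case
    using step by (auto intro: converse_rtranclp_into_rtranclp)
qed

text \<open>From its last visit to \<open>U\<close>, a walk to \<open>m\<close> avoids
  \<open>U\<close> and hence \<open>W\<close>, so \<open>U\<close> itself is not blocked by
  \<open>W\<close>. Any other class that needs \<open>W\<close> also needs \<open>U\<close>, by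
  \<open>avoid_blocked\<close>. The inclusion is strict because \<open>W\<close> does not block
  itself.\<close>

lemma blocked_blocked_psubset:
  assumes "U \<in> acc" "W \<in> blocked U"
  shows "blocked W \<subset> blocked U"
proof -
  have "U \<noteq> W"
    using assms by (auto simp: blocked_def)
  have "(avoid W)\<^sup>*\<^sup>* U m"
  proof -
    have "sh\<^sup>*\<^sup>* U m"
      using assms by (simp add: acc_def)
    then consider "(avoid U)\<^sup>*\<^sup>* U m" | "U = m" | j where "sh U j" "(avoid U)\<^sup>*\<^sup>* j m"
      using reachable_cases by blast
    then show ?thesis
    proof cases
      case 3
      then have "j \<noteq> W"
        using assms by (auto simp: blocked_def)
      then have "avoid W U j"
        using 3 \<open>U \<noteq> W\<close> assms(1) avoid_acc by (auto simp: avoid_def)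
      then show ?thesis
        using avoid_blocked[OF 3(2) assms(2)] by (rule converse_rtranclp_into_rtranclp)
    qed (use avoid_blocked assms in auto)
  qed
  then have "blocked W \<subseteq> blocked U"
    using avoid_blocked[OF _ assms(2)] by (auto simp: blocked_def)
  moreover have "W \<notin> blocked W"
    by (simp add: blocked_def)
  ultimately show ?thesis
    using assms(2) by blast
qed

text \<open>Take \<open>U\<close> with an inclusion-minimal nonempty set of blocked classes.\<close>

lemma terminal_block:
  obtains U where "U \<in> acc" "blocked U \<noteq> {}" "\<And>W. W \<in> blocked U \<Longrightarrow> blocked W = {}"
proof -
  \<comment> \<open>\<open>U = m\<close> is a candidate: \<open>blocked m = acc - {m}\<close> is
    nonempty by \<open>acc_not_singleton\<close>.\<close>
  have "\<exists>U. U \<in> acc \<and> blocked U \<noteq> {}"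
    using m_acc acc_not_singleton blocked_m by blast
  then obtain U where U: "U \<in> acc" "blocked U \<noteq> {}"
    and min: "\<And>W. W \<in> acc \<and> blocked W \<noteq> {} \<Longrightarrow> card (blocked U) \<le> card (blocked W)"
    using arg_min_natI[of "\<lambda>U. U \<in> acc \<and> blocked U \<noteq> {}" _ "\<lambda>U. card (blocked U)"]
      arg_min_nat_le[of "\<lambda>U. U \<in> acc \<and> blocked U \<noteq> {}" _ "\<lambda>U. card (blocked U)"]
    by blast
  have "blocked W = {}" if "W \<in> blocked U" for W
  proof (rule ccontr)
    assume "blocked W \<noteq> {}"
    then have "card (blocked U) \<le> card (blocked W)"
      using that min by (auto simp: blocked_def)
    moreover have "card (blocked W) < card (blocked U)"
      using blocked_blocked_psubset[OF U(1) that] finite_blocked by (rule psubset_card_mono[rotated])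
    ultimately show False by simp
  qed
  then show thesis
    using that U by blast
qed

text \<open>If \<open>x\<close> could move to \<open>j\<close>, its class would reach
  \<open>m\<close> through \<open>j\<close> without meeting \<open>U\<close>.\<close>

lemma blocked_deg_cls_pos:
  assumes "x \<in> V" "f x \<in> blocked U" "j \<in> acc - blocked U - {U}"
  shows "1 \<le> deg E (cls j) x"
proof (rule deg_cls_pos)
  show "j \<noteq> f x"
    using assms by auto
  show "\<not> movable V E f x j"
  proof
    assume "movable V E f x j"
    then have "avoid U (f x) j"
      using assms by (auto simp: avoid_def shifts_def blocked_def acc_def)
    moreover have "(avoid U)\<^sup>*\<^sup>* j m"
      using assms by (auto simp: blocked_def)
    ultimately have "(avoid U)\<^sup>*\<^sup>* (f x) m"
      by (rule converse_rtranclp_into_rtranclp)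
    then show False
      using assms by (simp add: blocked_def)
  qed
qed

section \<open>Solo edges and the two weighting arguments\<close>

lemma solo_exists:
  assumes "deg E (cls i) y = 1"
  obtains z where "z \<in> cls i" "solo z y" "{w \<in> cls i. E y w} = {z}"
proof -
  obtain z where z: "{w \<in> cls i. E y w} = {z}"
    using assms unfolding deg_def by (rule card_1_singletonE)
  then have "z \<in> cls i" "E z y"
    using sym by (auto dest: sympD)
  then show thesis
    using that z assms by (auto simp: solo_def colour_class_def)
qed

lemma solo_unique:
  assumes "solo z y" "w \<in> V" "f w = f z" "E y w" "z \<in> V"
  shows "w = z"
proof -
  obtain x where "{w \<in> cls (f z). E y w} = {x}"
    using assms(1) unfolding solo_def deg_def by (meson card_1_singletonE)
  then have "\<And>w. w \<in> V \<Longrightarrow> f w = f z \<Longrightarrow> E y w \<Longrightarrow> w = x"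
    by (auto simp: colour_class_def)
  moreover have "E y z"
    using assms(1) sym by (auto simp: solo_def dest: sympD)
  ultimately show ?thesis
    using assms by metis
qed

text \<open>Every accessible class contains a neighbour of \<open>y\<close>, and a class of
  \<open>T\<close> that is not solo for \<open>y\<close> contains at least two. The degree bound
  leaves room for few such classes.\<close>

lemma many_solo_classes:
  assumes "y \<in> B" "T \<subseteq> acc"
  shows "card T + deg E B y < card {i\<in>T. deg E (cls i) y = 1} + q"
proof -
  have fin: "finite T"
    using assms(2) finite_acc by (rule finite_subset)
  have "card T = card {i\<in>T. deg E (cls i) y = 1} + card {i\<in>T. deg E (cls i) y \<noteq> 1}"
    using fin by (subst card_Un_disjoint[symmetric]) (auto intro!: arg_cong[where f = card])
  moreover have "card acc + card {i\<in>T. deg E (cls i) y \<noteq> 1}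
      = (\<Sum>i\<in>acc. 1 + of_bool (i \<in> T \<and> deg E (cls i) y \<noteq> 1))"
    using assms(2) finite_acc
    by (subst sum.distrib) (auto simp: Int_def intro!: arg_cong[where f = card])
  moreover have "\<dots> \<le> (\<Sum>i\<in>acc. deg E (cls i) y)"
  proof (rule sum_mono)
    fix i assume "i \<in> acc"
    then show "1 + of_bool (i \<in> T \<and> deg E (cls i) y \<noteq> 1) \<le> deg E (cls i) y"
      using B_deg_cls_pos[OF assms(1), of i] by auto
  qed
  moreover have "y \<in> V"
    using assms(1) by (simp add: B_def)
  ultimately show ?thesis
    using deg_split[of y] by linarith
qed

text \<open>Double counting of the edges between \<open>W\<close> and \<open>B\<close>, with weight 2 on the edges at solo vertices
  of \<open>W\<close>, so that every vertex of \<open>B\<close> receives total weight at least 2.\<close>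

lemma q_less_card_blocked:
  assumes U: "U \<in> acc" and W: "W \<in> blocked U"
    and fixed: "\<And>z y X. z \<in> cls W \<Longrightarrow> y \<in> B \<Longrightarrow> solo z y \<Longrightarrow> X \<in> acc \<Longrightarrow> \<not> movable V E f z X"
  shows "q < card (blocked U)"
proof (rule ccontr)
  let ?t = "card (blocked U)"
  assume "\<not> q < ?t"
  define S where "S = {z \<in> cls W. \<exists>y\<in>B. solo z y}"
  have S: "S \<subseteq> cls W"
    by (auto simp: S_def)
  have fin: "finite S" "finite (cls W - S)"
    using S finite_cls by (auto intro: finite_subset)
  have W': "W \<in> acc" "W \<noteq> m"
    using W m_not_blocked by (auto simp: blocked_def)
  \<comment> \<open>By \<open>fixed\<close>, \<open>z\<close> has a neighbour in every accessible
    class but its own.\<close>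
  have degS: "deg E B z \<le> q" if "z \<in> S" for z
  proof -
    have z: "z \<in> V" "f z = W"
      using that by (auto simp: S_def colour_class_def)
    have "card (acc - {W}) + deg E B z < card acc + q"
    proof (rule deg_B_less)
      fix i assume "i \<in> acc - {W}"
      then show "1 \<le> deg E (cls i) z"
        using z that fixed by (intro deg_cls_pos) (auto simp: S_def)
    qed (use z in auto)
    then show ?thesis
      using W'(1) finite_acc by (simp add: card_Diff_singleton_if split: if_splits)
  qed
  \<comment> \<open>A vertex of \<open>W\<close> has a neighbour in every accessible class outside
    \<open>insert U (blocked U)\<close>; the \<open>?t + 1\<close> classes left out account for the
    larger bound.\<close>
  have degD: "deg E B x \<le> ?t + q" if "x \<in> cls W - S" for x
  proof -
    have x: "x \<in> V" "f x = W"
      using that by (auto simp: colour_class_def)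
    have "card (acc - (insert U (blocked U))) + deg E B x < card acc + q"
      using x W by (intro deg_B_less blocked_deg_cls_pos[of x U]) auto
    moreover have "insert U (blocked U) \<subseteq> acc"
      using U by (auto simp: blocked_def)
    then have "card (acc - (insert U (blocked U))) + card (insert U (blocked U)) = card acc"
      using finite_acc by (metis card_Diff_subset card_mono finite_subset le_add_diff_inverse2)
    moreover have "card (insert U (blocked U)) = Suc ?t"
      using finite_blocked by (simp add: blocked_def)
    ultimately show ?thesis by linarith
  qed
  have "2 \<le> 2 * deg E S y + deg E (cls W - S) y" if y: "y \<in> B" for y
  proof (cases "deg E (cls W) y = 1")
    case True
    then obtain z where z: "z \<in> cls W" "solo z y" "{w \<in> cls W. E y w} = {z}"
      by (rule solo_exists)
    then have "z \<in> S"
      using y by (auto simp: S_def)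
    then have "{w \<in> S. E y w} = {z}"
      using z S by auto
    then show ?thesis
      by (simp add: deg_def)
  next
    case False
    then have "2 \<le> deg E (cls W) y"
      using B_deg_cls_pos[OF y W'(1)] by linarith
    also have "deg E (cls W) y = deg E S y + deg E (cls W - S) y"
      using S fin unfolding deg_def
      by (subst card_Un_disjoint[symmetric]) (auto intro!: arg_cong[where f = card])
    finally show ?thesis by linarith
  qed
  then have "2 * card B \<le> (\<Sum>y\<in>B. 2 * deg E S y + deg E (cls W - S) y)"
    using sum_mono[of B "\<lambda>_. 2" "\<lambda>y. 2 * deg E S y + deg E (cls W - S) y"] by simp
  also have "\<dots> = 2 * (\<Sum>z\<in>S. deg E B z) + (\<Sum>x\<in>cls W - S. deg E B x)"
    by (simp add: sum.distrib sum_distrib_left[symmetric] sum_deg_commute[OF finite_B _ sym] fin)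
  \<comment> \<open>Every vertex of \<open>W\<close> now carries at most \<open>2 * q\<close>: those
    in \<open>S\<close> by the doubled weight, the others because \<open>?t \<le> q\<close> is
    assumed. The total \<open>2 * q * s\<close> is less than \<open>2 * card B\<close>.\<close>
  also have "\<dots> \<le> 2 * (\<Sum>z\<in>S. q) + (\<Sum>x\<in>cls W - S. 2 * q)"
  proof -
    have "deg E B x \<le> 2 * q" if "x \<in> cls W - S" for x
      using degD[OF that] \<open>\<not> q < ?t\<close> by linarith
    then show ?thesis
      using degS by (intro add_mono mult_left_mono sum_mono) auto
  qed
  also have "\<dots> = 2 * q * (card S + card (cls W - S))"
    by (simp add: algebra_simps)
  also have "card S + card (cls W - S) = s"
    using S fin card_cls_acc[OF W']
    by (subst card_Un_disjoint[symmetric]) (auto simp: Un_absorb1)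
  finally show False
    using card_B by simp
qed

text \<open>Every solo vertex distributes weight 1 equally over its solo edges. If the solo neighbours of each
  vertex were cliques, every \<open>y \<in> B\<close> would receive at least \<open>card T / q\<close>, which is too much in total.\<close>

lemma solo_weights:
  assumes T: "T \<subseteq> acc" "m \<notin> T" "q < card T"
    and clique: "\<And>z y y'. z \<in> V \<Longrightarrow> f z \<in> T \<Longrightarrow> y \<in> B \<Longrightarrow> y' \<in> B \<Longrightarrow>
      solo z y \<Longrightarrow> solo z y' \<Longrightarrow> y \<noteq> y' \<Longrightarrow> E y y'"
  shows False
proof -
  define A where "A = {v\<in>V. f v \<in> T}"
  define N where "N z = {y\<in>B. solo z y}" for z
  have fin: "finite T" "finite A"
    using T finite_acc finite_V by (auto simp: A_def intro: finite_subset)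
  have "card A = (\<Sum>i\<in>T. card (cls i))"
    unfolding A_def using finite_V fin(1) by (rule card_union_classes)
  also have "\<dots> = (\<Sum>i\<in>T. s)"
  proof (rule sum.cong)
    fix i assume "i \<in> T"
    then show "card (cls i) = s"
      using T by (intro card_cls_acc) auto
  qed simp
  finally have card_A: "card A = card T * s" by simp
  have weight: "real (card T) / q \<le> (\<Sum>z | z \<in> A \<and> solo z y. 1 / card (N z))" if y: "y \<in> B" for y
  proof -
    define c where "c = Suc (deg E B y)"
    have "bij_betw f {z\<in>A. solo z y} {i\<in>T. deg E (cls i) y = 1}"
      unfolding bij_betw_def
    proof
      show "inj_on f {z\<in>A. solo z y}"
      proof (rule inj_onI)
        fix z w assume *: "z \<in> {z\<in>A. solo z y}" "w \<in> {z\<in>A. solo z y}" "f z = f w"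
        then have "E y w"
          using sym by (auto simp: solo_def dest: sympD)
        then show "z = w"
          using * by (intro solo_unique[of z y w, symmetric]) (simp_all add: A_def)
      qed
      show "f ` {z\<in>A. solo z y} = {i\<in>T. deg E (cls i) y = 1}"
      proof
        show "f ` {z\<in>A. solo z y} \<subseteq> {i\<in>T. deg E (cls i) y = 1}"
          by (auto simp: A_def solo_def)
        show "{i\<in>T. deg E (cls i) y = 1} \<subseteq> f ` {z\<in>A. solo z y}"
        proof
          fix i assume i: "i \<in> {i\<in>T. deg E (cls i) y = 1}"
          then obtain z where "z \<in> cls i" "solo z y"
            using solo_exists[of i y] by blast
          then show "i \<in> f ` {z\<in>A. solo z y}"
            using i by (auto simp: A_def colour_class_def)
        qed
      qed
    qed
    then have "card T + c \<le> card {z\<in>A. solo z y} + q"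
      using many_solo_classes[OF y T(1)] by (simp add: c_def bij_betw_same_card)
    then have many: "real (card T) - q + c \<le> card {z\<in>A. solo z y}"
      by linarith
    have c: "0 < c" "c \<le> q"
      using deg_B_B[OF y] by (auto simp: c_def)
    have le_c: "1 / real c \<le> 1 / card (N z)" if z: "z \<in> A" "solo z y" for z
    proof -
      \<comment> \<open>\<open>N z\<close> is a clique containing \<open>y\<close>, so its other
        members are among the \<open>c - 1\<close> neighbours of \<open>y\<close> in
        \<open>B\<close>.\<close>
      have "N z \<subseteq> insert y {w\<in>B. E y w}"
        using clique z y by (auto simp: N_def A_def)
      then have "card (N z) \<le> card (insert y {w\<in>B. E y w})"
        using finite_B by (intro card_mono) auto
      also have "\<dots> \<le> c"
        by (simp add: c_def deg_def card_insert_le_m1)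
      finally have "card (N z) \<le> c" .
      moreover have "0 < card (N z)"
        using z y finite_B by (auto simp: N_def card_gt_0_iff)
      ultimately show ?thesis
        by (simp add: frac_le)
    qed
    \<comment> \<open>At least \<open>card T - q + c\<close> solo vertices in \<open>A\<close> give
      \<open>y\<close> weight \<open>1 / c\<close> or more each. Since
      \<open>c \<le> q < card T\<close>, the resulting bound is smallest at
      \<open>c = q\<close>.\<close>
    have "real (card T) / q = (real (card T) - q) / q + 1"
      using q_pos by (simp add: field_simps)
    also have "\<dots> \<le> (real (card T) - q) / c + 1"
      using c T(3) by (intro add_right_mono divide_left_mono) auto
    also have "\<dots> = (real (card T) - q + c) / c"
      using c by (simp add: field_simps)
    also have "\<dots> \<le> card {z\<in>A. solo z y} / c"
      using many c by (intro divide_right_mono) auto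
    also have "\<dots> = (\<Sum>z | z \<in> A \<and> solo z y. 1 / c)"
      by simp
    also have "\<dots> \<le> (\<Sum>z | z \<in> A \<and> solo z y. 1 / card (N z))"
      using le_c by (intro sum_mono) auto
    finally show ?thesis .
  qed
  have "card B * (real (card T) / q) = (\<Sum>y\<in>B. real (card T) / q)"
    by simp
  also have "\<dots> \<le> (\<Sum>y\<in>B. \<Sum>z | z \<in> A \<and> solo z y. 1 / card (N z))"
    using weight by (rule sum_mono)
  also have "\<dots> = (\<Sum>z\<in>A. \<Sum>y | y \<in> B \<and> solo z y. 1 / card (N z))"
    by (rule sum.swap_restrict[symmetric]) (use fin finite_B in auto)
  \<comment> \<open>The inner sum is 1 if \<open>N z\<close> is nonempty and 0 otherwise.\<close>
  also have "\<dots> \<le> (\<Sum>z\<in>A. 1)"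
    by (intro sum_mono) (simp add: N_def[symmetric])
  also have "\<dots> = card T * s"
    using card_A by simp
  finally have "real (card B) * card T \<le> real (card T * s) * q"
    using q_pos by (simp add: field_simps)
  then have "card B * card T \<le> card T * s * q"
    by (simp only: of_nat_mult[symmetric] of_nat_le_iff)
  then show False
    using T(3) by (simp add: card_B algebra_simps)
qed

text \<open>Suppose there is no such vertex and take \<open>U\<close> from
  \<open>terminal_block\<close>. Failure of the first alternative gives
  \<open>q < card (blocked U)\<close>; failure of the second makes the solo neighbours cliques,
  which \<open>solo_weights\<close> refutes for \<open>T = blocked U\<close>.\<close>

lemma special_vertex:
  obtains (special) W z y where "W \<in> acc" "W \<noteq> m" "blocked W = {}" "z \<in> V" "f z = W" "y \<in> B" "solo z y"
    "(\<exists>X\<in>acc. movable V E f z X) \<or> (\<exists>y'\<in>B. y' \<noteq> y \<and> solo z y' \<and> \<not> E y y')"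
proof (rule ccontr)
  assume "\<not> thesis"
  then have none: "\<not> ((\<exists>X\<in>acc. movable V E f z X) \<or> (\<exists>y'\<in>B. y' \<noteq> y \<and> solo z y' \<and> \<not> E y y'))"
    if "f z \<in> acc" "f z \<noteq> m" "blocked (f z) = {}" "z \<in> V" "y \<in> B" "solo z y" for z y
    using special[of "f z" z y] that \<open>\<not> thesis\<close> by blast
  obtain U where U: "U \<in> acc" "blocked U \<noteq> {}" "\<And>W. W \<in> blocked U \<Longrightarrow> blocked W = {}"
    by (rule terminal_block) blast
  have none: "\<not> (\<exists>X\<in>acc. movable V E f z X)" "\<not> (\<exists>y'\<in>B. y' \<noteq> y \<and> solo z y' \<and> \<not> E y y')"
    if "f z \<in> blocked U" "z \<in> V" "y \<in> B" "solo z y" for z y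
    using none[of z y] that U(3)[of "f z"] m_not_blocked by (auto simp: blocked_def)
  obtain W where W: "W \<in> blocked U"
    using U(2) by blast
  have "q < card (blocked U)"
    using U(1) W
  proof (rule q_less_card_blocked)
    fix z y X assume "z \<in> cls W" "y \<in> B" "solo z y" "X \<in> acc"
    then show "\<not> movable V E f z X"
      using none(1)[of z y] W by (auto simp: colour_class_def)
  qed
  with _ m_not_blocked show False
    by (rule solo_weights) (use none(2) in \<open>auto simp: blocked_def\<close>)
qed


section \<open>Exchanging the two ends of a solo edge\<close>

lemma V_minus_B: "v \<in> V \<Longrightarrow> v \<notin> B \<longleftrightarrow> f v \<in> acc"
  using colours by (auto simp: B_def)

text \<open>Intended for a solo edge: \<open>y\<close> may enter the class of \<open>z\<close>
  because its only neighbour there leaves.\<close>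

definition exchange :: "('a \<Rightarrow> 'c) \<Rightarrow> 'a \<Rightarrow> 'a \<Rightarrow> 'c \<Rightarrow> 'a \<Rightarrow> 'c" where
  "exchange g z y X = (\<lambda>v. if v = y then f z else if v \<in> B then g v else f v)(z := X)"

context
  fixes g :: "'a \<Rightarrow> 'c" and z y :: 'a and X :: 'c
  assumes z: "z \<in> V" "f z \<in> acc" "f z \<noteq> m" and y: "y \<in> B" "solo z y"
    and g: "equitable (B - {y}) E (C - acc) s g"
    and X: "X \<in> C" "X \<noteq> f z"
begin

lemma g_colour: "v \<in> B \<Longrightarrow> v \<noteq> y \<Longrightarrow> g v \<in> C - acc"
  using g by (auto simp: equitable_def colouring_def)

lemma z_not_B: "z \<notin> B"
  using z V_minus_B by blast

lemma exchange_z: "exchange g z y X z = X"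
  and exchange_y: "exchange g z y X y = f z"
  and exchange_B: "v \<in> B \<Longrightarrow> v \<noteq> y \<Longrightarrow> exchange g z y X v = g v"
  and exchange_A: "v \<notin> B \<Longrightarrow> v \<noteq> z \<Longrightarrow> exchange g z y X v = f v"
  using z_not_B y by (auto simp: exchange_def)

lemma exchange_eq_acc:
  assumes "v \<in> V" "i \<in> acc" "i \<noteq> f z" "i \<noteq> X"
  shows "exchange g z y X v = i \<longleftrightarrow> f v = i"
proof (cases "v = z \<or> v = y")
  case True
  then show ?thesis
    using assms y V_minus_B[of y] exchange_z exchange_y by (auto simp: B_def)
next
  case False
  then show ?thesis
    using assms g_colour[of v] V_minus_B[of v] exchange_A[of v] exchange_B[of v] by (cases "v \<in> B") auto
qed

text \<open>Removing \<open>y\<close> cures the surplus of \<open>B\<close>, and the class of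
  \<open>z\<close> trades \<open>z\<close> for \<open>y\<close>, so the surplus ends up where
  \<open>z\<close> lands. That \<open>z\<close> fits into \<open>X\<close> is left as the premise
  \<open>free\<close>, since \<open>X\<close> is accessible in one application and inaccessible in
  the other.\<close>

lemma nearly_equitable_exchange:
  assumes free: "\<And>w. w \<in> V \<Longrightarrow> w \<noteq> z \<Longrightarrow> exchange g z y X w = X \<Longrightarrow> \<not> E z w"
  shows "nearly_equitable V E C s (exchange g z y X) X m"
proof -
  let ?h = "\<lambda>v. if v = y then f z else if v \<in> B then g v else f v"
  have y': "y \<in> V" "f y \<notin> acc"
    using y by (auto simp: B_def)
  have "exchange g z y X v \<in> C" if "v \<in> V" for v
    using that colours z acc_subset X g_colour[of v] by (auto simp: exchange_def)
  moreover have proper: "\<not> E u v"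
    if "u \<in> V" "v \<in> V" "exchange g z y X u = exchange g z y X v" "u \<noteq> z" "v \<noteq> z" for u v
  proof -
    \<comment> \<open>Apart from \<open>y\<close> itself, whatever now shares the class of
      \<open>y\<close> was in the class of \<open>z\<close> before.\<close>
    have y_case: "\<not> E y v" if v: "v \<in> V" "exchange g z y X v = f z" "v \<noteq> z" for v
    proof (cases "v = y")
      case True
      then show ?thesis
        using irrefl by (auto simp: irreflp_def)
    next
      case False
      then have "v \<notin> B" "f v = f z"
        using v z g_colour[of v] exchange_A[of v] exchange_B[of v] by (cases "v \<in> B"; auto)+
      then show ?thesis
        using v z y solo_unique[of z y v] by auto
    qed
    consider "u = y" | "v = y" | "u \<noteq> y" "v \<noteq> y" by blast
    then show ?thesis
    proof cases
      case 1
      then show ?thesis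
        using y_case[of v] that exchange_y by auto
    next
      case 2
      then show ?thesis
        using y_case[of u] that exchange_y sym by (auto dest: sympD)
    next
      case 3
      show ?thesis
      proof (cases "u \<in> B"; cases "v \<in> B")
        assume "u \<in> B" "v \<in> B"
        then show ?thesis
          using 3 that g exchange_B by (auto simp: equitable_def colouring_def)
      next
        assume "u \<in> B" "v \<notin> B"
        then show ?thesis
          using 3 that g_colour[of u] V_minus_B[of v] exchange_A[of v] exchange_B[of u] by auto
      next
        assume "u \<notin> B" "v \<in> B"
        then show ?thesis
          using 3 that g_colour[of v] V_minus_B[of u] exchange_A[of u] exchange_B[of v] by auto
      next
        assume "u \<notin> B" "v \<notin> B"
        then show ?thesis
          using 3 that near exchange_A by (auto simp: nearly_equitable_def colouring_def)
      qed
    qed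
  qed
  have "exchange g z y X u \<noteq> exchange g z y X v" if "u \<in> V" "v \<in> V" "E u v" for u v
  proof -
    have "u \<noteq> v"
      using that(3) irrefl by (auto simp: irreflp_def)
    then show ?thesis
      using that proper[of u v] free[of u] free[of v] exchange_z sym
      by (cases "u = z"; cases "v = z") (auto dest: sympD)
  qed
  moreover have "card (colour_class V (exchange g z y X) i) + of_bool (i = m) = s + of_bool (i = X)"
    if i: "i \<in> C" for i
  proof -
    \<comment> \<open>Before \<open>z\<close> moves, its class holds both \<open>z\<close> and
      \<open>y\<close> and carries the surplus; \<open>card_class_upd\<close> then accounts for the
      move to \<open>X\<close>.\<close>
    have "card (colour_class V ?h i) + of_bool (i = m) = s + of_bool (i = f z)"
    proof (cases "i \<in> acc")
      case True
      have "?h v = i \<longleftrightarrow> v = y \<and> i = f z \<or> f v = i" if "v \<in> V" for v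
        using that True y y' g_colour[of v] V_minus_B[of v] by auto
      then have "colour_class V ?h i = {v\<in>V. v = y \<and> i = f z \<or> f v = i}"
        unfolding colour_class_def by blast
      then have "colour_class V ?h i = (if i = f z then insert y (cls i) else cls i)"
        using y' by (auto simp: colour_class_def)
      moreover have "y \<notin> cls i"
        using True y' by (auto simp: colour_class_def)
      moreover have "i \<noteq> p"
        using True p_not_acc by auto
      ultimately show ?thesis
        using card_cls[OF i] finite_cls z by auto
    next
      case False
      have "?h v = i \<longleftrightarrow> v \<noteq> y \<and> v \<in> B \<and> g v = i" if "v \<in> V" for v
        using that False z V_minus_B[of v] by auto
      then have "colour_class V ?h i = {v \<in> V. v \<noteq> y \<and> v \<in> B \<and> g v = i}"
        unfolding colour_class_def by blast
      also have "\<dots> = colour_class (B - {y}) g i"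
        by (auto simp: colour_class_def B_def)
      finally have "card (colour_class V ?h i) = s"
        using g False i by (simp add: equitable_def)
      then show ?thesis
        using False m_acc z by auto
    qed
    moreover have "?h z = f z"
      using z_not_B y by auto
    ultimately show ?thesis
      using card_class_upd[OF finite_V z(1), of ?h X i] unfolding exchange_def by simp
  qed
  ultimately show ?thesis
    using X m_acc acc_subset by (auto simp: nearly_equitable_def colouring_def)
qed

text \<open>Accessible classes other than \<open>f z\<close> and \<open>X\<close> are untouched. As
  a source, \<open>X\<close> does no harm because it only gains \<open>z\<close>; as a target it is
  excluded, since \<open>z\<close> may be adjacent to the moving vertex.\<close>

lemma shifts_exchange:
  assumes "avoid (f z) i j" "j \<noteq> X"
  shows "shifts V E C (exchange g z y X) i j"
proof -
  have ij: "i \<in> acc" "j \<in> acc" "i \<noteq> f z" "j \<noteq> f z" "sh i j"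
    using assms by (auto simp: avoid_def)
  then obtain v where v: "v \<in> V" "f v = i" "movable V E f v j"
    by (auto simp: shifts_def)
  then have "v \<notin> B" "v \<noteq> z"
    using ij V_minus_B by auto
  then have "exchange g z y X v = i"
    using v exchange_A by simp
  then have "movable V E (exchange g z y X) v j"
    using v ij assms(2) exchange_eq_acc by (auto simp: movable_def)
  then show ?thesis
    using \<open>exchange g z y X v = i\<close> v ij acc_subset by (auto simp: shifts_def)
qed

end

text \<open>If \<open>z\<close> moves to an accessible class \<open>X\<close>, then \<open>m\<close> is still reachable from \<open>X\<close> since \<open>W\<close> blocks nothing.
  Otherwise \<open>z\<close> moves to some class outside \<open>acc\<close>, and the class of the second solo neighbour \<open>y'\<close>
  becomes accessible through \<open>W\<close>.\<close>

lemma step_towards_equitable: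
  assumes IH: "\<And>z y. z \<in> V - B \<Longrightarrow> y \<in> B \<Longrightarrow> E z y \<Longrightarrow> \<exists>g. equitable (B - {y}) E (C - acc) s g"
  shows "(\<exists>g. equitable V E C s g) \<or>
    (\<exists>h X. nearly_equitable V E C s h X m \<and>
       card acc < card {i\<in>C. (shifts V E C h)\<^sup>*\<^sup>* i m})"
proof -
  obtain W z y where W: "W \<in> acc" "W \<noteq> m" "blocked W = {}" and z: "z \<in> V" "f z = W"
    and y: "y \<in> B" "solo z y"
    and cases: "(\<exists>X\<in>acc. movable V E f z X) \<or> (\<exists>y'\<in>B. y' \<noteq> y \<and> solo z y' \<and> \<not> E y y')"
    by (rule special_vertex)
  obtain g where g: "equitable (B - {y}) E (C - acc) s g"
    using IH[of z y] z y W V_minus_B by (auto simp: solo_def)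
  have reach: "(avoid W)\<^sup>*\<^sup>* i m" if "i \<in> acc" "i \<noteq> W" for i
    using that W by (auto simp: blocked_def)
  have zacc: "f z \<in> acc" "f z \<noteq> m"
    using z W by auto
  note exch = z(1) zacc y g
  show ?thesis
  proof (cases "\<exists>X\<in>acc. movable V E f z X")
    case True
    then obtain X where X: "X \<in> acc" "movable V E f z X" by blast
    then have X': "X \<in> C" "X \<noteq> f z"
      using acc_subset by (auto simp: movable_def)
    have "nearly_equitable V E C s (exchange g z y X) X m"
    proof (rule nearly_equitable_exchange[OF exch X'])
      fix w assume w: "w \<in> V" "w \<noteq> z" "exchange g z y X w = X"
      then have "w \<notin> B"
        using g_colour[OF exch X', of w] exchange_B[OF exch X', of w] exchange_y[OF exch X'] X X'
        by (cases "w = y") auto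
      then show "\<not> E z w"
        using w X exchange_A[OF exch X', of w] by (auto simp: movable_def)
    qed
    \<comment> \<open>Distinctness keeps \<open>X\<close> from recurring as a target, as
      \<open>shifts_exchange\<close> demands.\<close>
    moreover obtain xs where "rtrancl_path (avoid W) X xs m" "distinct (X # xs)"
    proof -
      obtain ys where "rtrancl_path (avoid W) X ys m"
        using reach[of X] X X' z by (auto simp: rtranclp_eq_rtrancl_path)
      then show thesis
        using that by (rule rtrancl_path_distinct)
    qed
    moreover from this have "rtrancl_path (shifts V E C (exchange g z y X)) X xs m"
      by (elim rtrancl_path_mono_targets) (use z in \<open>auto intro!: shifts_exchange[OF exch X']\<close>)
    ultimately have "\<exists>g. equitable V E C s g"
      by (intro equitable_if_path[OF _ _ _ finite_V sym irrefl])
    then show ?thesis ..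
  next
    case False
    then obtain y' where y': "y' \<in> B" "y' \<noteq> y" "solo z y'" "\<not> E y y'"
      using cases by blast
    \<comment> \<open>As \<open>z\<close> fits into no accessible class, it has at most
      \<open>q\<close> neighbours in \<open>B\<close>, and \<open>y\<close> is one of them. Without
      \<open>y\<close>, one of the \<open>q\<close> colours used by \<open>g\<close> is free for
      \<open>z\<close>.\<close>
    have "deg E (B - {y}) z < q"
    proof -
      have "card (acc - {W}) + deg E B z < card acc + q"
      proof (rule deg_B_less)
        fix i assume "i \<in> acc - {W}"
        then show "1 \<le> deg E (cls i) z"
          using False z by (intro deg_cls_pos) auto
      qed (use z in auto)
      then have "deg E B z \<le> q"
        using W finite_acc by (simp add: card_Diff_singleton_if split: if_splits)
      moreover have "deg E (B - {y}) z < deg E B z"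
        unfolding deg_def using y finite_B
        by (intro psubset_card_mono) (auto simp: solo_def)
      ultimately show ?thesis by simp
    qed
    then obtain Y where Y: "Y \<in> C - acc" "\<And>w. w \<in> B - {y} \<Longrightarrow> g w = Y \<Longrightarrow> \<not> E z w"
      using free_colour[of "B - {y}" "C - acc" E z g] finite_B finite_C unfolding q_def by blast
    then have Y': "Y \<in> C" "Y \<noteq> f z"
      using W z by auto
    define h where "h = exchange g z y Y"
    have hz: "h z = Y" and hy: "h y = f z" and hB: "\<And>v. v \<in> B \<Longrightarrow> v \<noteq> y \<Longrightarrow> h v = g v"
      and hA: "\<And>v. v \<notin> B \<Longrightarrow> v \<noteq> z \<Longrightarrow> h v = f v"
      unfolding h_def using exchange_z[OF exch Y'] exchange_y[OF exch Y'] exchange_B[OF exch Y']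
        exchange_A[OF exch Y'] by auto
    have h: "nearly_equitable V E C s h Y m"
      unfolding h_def
    proof (rule nearly_equitable_exchange[OF exch Y'])
      fix w assume w: "w \<in> V" "w \<noteq> z" "exchange g z y Y w = Y"
      then have "w \<in> B" "w \<noteq> y"
        using hA[of w] hy Y' Y V_minus_B[of w] unfolding h_def by auto
      then show "\<not> E z w"
        using w Y(2)[of w] hB[of w] unfolding h_def by auto
    qed
    let ?R = "shifts V E C h"
    have reach_h: "?R\<^sup>*\<^sup>* i m" if "i \<in> acc" "i \<noteq> W" for i
      using reach[OF that]
    proof (rule mono_rtranclp[rule_format, rotated])
      fix a b assume ab: "avoid W a b"
      then have "b \<noteq> Y"
        using Y by (auto simp: avoid_def)
      then show "?R a b"
        unfolding h_def using ab z by (intro shifts_exchange[OF exch Y']) auto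
    qed
    \<comment> \<open>The first move from \<open>W\<close> towards \<open>m\<close> is made by a
      vertex other than \<open>z\<close>, which cannot move to an accessible class here; so this
      move survives the exchange.\<close>
    have "?R\<^sup>*\<^sup>* W m"
    proof -
      have "sh\<^sup>*\<^sup>* W m"
        using W by (simp add: acc_def)
      then obtain j where j: "sh W j" "sh\<^sup>*\<^sup>* j m"
        using W(2) by (auto elim: converse_rtranclpE)
      then obtain v where v: "v \<in> V" "f v = W" "movable V E f v j"
        by (auto simp: shifts_def)
      have j': "j \<in> acc" "j \<noteq> W" "j \<noteq> Y"
        using j v Y by (auto simp: acc_def shifts_def movable_def)
      have "v \<noteq> z"
        using v(3) j'(1) False by auto
      then have "h v = W"
        using v W V_minus_B[of v] hA by auto
      moreover have "movable V E h v j"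
        using v j' \<open>h v = W\<close> exchange_eq_acc[OF exch Y', of _ j] z by (auto simp: movable_def h_def)
      ultimately have "?R W j"
        using v(1) W j' acc_subset by (auto simp: shifts_def)
      then show ?thesis
        using reach_h[OF j'(1,2)] by (rule converse_rtranclp_into_rtranclp)
    qed
    then have reach_acc: "?R\<^sup>*\<^sup>* i m" if "i \<in> acc" for i
      using that reach_h by blast
    have gy': "g y' \<in> C - acc"
      using g_colour[OF exch Y'] y' by auto
    \<comment> \<open>\<open>y'\<close> can now enter \<open>W\<close>: its only neighbour
      \<open>z\<close> there has left, and the newcomer \<open>y\<close> is not adjacent to
      it.\<close>
    have "?R (g y') W"
    proof -
      have "\<not> E y' w" if w: "w \<in> V" "h w = W" for w
      proof (cases "w = y")
        case True
        then show ?thesis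
          using y' sym by (auto dest: sympD)
      next
        case False
        have "w \<noteq> z"
          using w hz Y' z by auto
        moreover have "w \<notin> B"
          using False w hB[of w] g_colour[OF exch Y', of w] W by auto
        ultimately have "f w = f z"
          using hA w z by auto
        then show ?thesis
          using solo_unique[of z y' w] y' w z \<open>w \<noteq> z\<close> by auto
      qed
      moreover have "h y' = g y'"
        using hB y' by auto
      ultimately show ?thesis
        using gy' W acc_subset y' by (auto simp: shifts_def movable_def B_def)
    qed
    then have "?R\<^sup>*\<^sup>* (g y') m"
      using reach_acc[OF W(1)] by (rule converse_rtranclp_into_rtranclp)
    then have "acc \<subset> {i\<in>C. ?R\<^sup>*\<^sup>* i m}"
      using gy' reach_acc acc_subset by auto
    then show ?thesis
      using h finite_C by (auto intro!: psubset_card_mono)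
  qed
qed

end

section \<open>The Hajnal-Szemeredi theorem by induction\<close>

lemma equitable_if_nearly_equitable:
  fixes f :: "'a \<Rightarrow> 'c"
  assumes "finite V" "finite C" "symp E" "irreflp E"
    and degree: "\<And>v. v \<in> V \<Longrightarrow> deg E V v < card C"
    and near: "nearly_equitable V E C s f p m"
    and IH: "\<And>V' C' u v. V' \<subseteq> V \<Longrightarrow> C' \<subseteq> C \<Longrightarrow> u \<in> V - V' \<Longrightarrow> v \<in> V - V' \<Longrightarrow> E u v \<Longrightarrow>
      card V' = card C' * s \<Longrightarrow> (\<And>w. w \<in> V' \<Longrightarrow> deg E V' w < card C') \<Longrightarrow>
      \<exists>g :: 'a \<Rightarrow> 'c. equitable V' E C' s g"
  shows "\<exists>g :: 'a \<Rightarrow> 'c. equitable V E C s g"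
  using near
\<comment> \<open>The measure is the number of inaccessible classes; an exchange that does not
  finish the repair lowers it.\<close>
proof (induction "card C - card {i\<in>C. (shifts V E C f)\<^sup>*\<^sup>* i m}" arbitrary: f p rule: less_induct)
  case less
  show ?case
  proof (cases "(shifts V E C f)\<^sup>*\<^sup>* p m")
    case True
    then show ?thesis
      using less.prems assms(1,3,4) by (rule equitable_if_reachable)
  next
    case False
    then interpret stuck_colouring V E C s f p m
      using assms less.prems by unfold_locales auto
    \<comment> \<open>\<open>IH\<close> asks for an edge with both ends outside the smaller vertex
      set, witnessing a descent in the number of edges; the solo edge between \<open>z\<close> and
      \<open>y\<close> is one.\<close>
    have "\<exists>g :: 'a \<Rightarrow> 'c. equitable (B - {y}) E (C - acc) s g"
      if zy: "z \<in> V - B" "y \<in> B" "E z y" for z y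
    proof (rule IH)
      show "z \<in> V - (B - {y})" "y \<in> V - (B - {y})" "E z y"
        using zy by (auto simp: B_def)
      show "B - {y} \<subseteq> V" "C - acc \<subseteq> C"
        by (auto simp: B_def)
      show "card (B - {y}) = card (C - acc) * s"
        using card_B zy finite_B by (simp add: q_def)
      show "deg E (B - {y}) w < card (C - acc)" if "w \<in> B - {y}" for w
        using deg_B_B[of w] deg_mono[of B "B - {y}" E w] finite_B that by (auto simp: q_def)
    qed
    then consider "\<exists>g :: 'a \<Rightarrow> 'c. equitable V E C s g" |
        h X where "nearly_equitable V E C s h X m"
          "card acc < card {i\<in>C. (shifts V E C h)\<^sup>*\<^sup>* i m}"
      using step_towards_equitable by blast
    then show ?thesis
    proof cases
      case 2
      have "card {i\<in>C. (shifts V E C h)\<^sup>*\<^sup>* i m} \<le> card C"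
        using finite_C by (intro card_mono) auto
      then show ?thesis
        using 2 less.hyps[of h X] by (auto simp: acc_def)
    qed
  qed
qed

text \<open>The edgeless base case: identify \<open>V\<close> with \<open>C \<times> {..<s}\<close>
  and colour by the first component.\<close>

lemma equipartition_exists:
  assumes "finite V" "finite C" "card V = card C * s"
  shows "\<exists>f. f ` V \<subseteq> C \<and> (\<forall>i\<in>C. card (colour_class V f i) = s)"
proof -
  have "card V = card (C \<times> {..<s})"
    using assms by (simp add: card_cartesian_product)
  then obtain h where h: "bij_betw h V (C \<times> {..<s})"
    using assms finite_same_card_bij[of V "C \<times> {..<s}"] by auto
  have "card (colour_class V (fst \<circ> h) i) = s" if "i \<in> C" for i
  proof -
    have "h ` colour_class V (fst \<circ> h) i = {x \<in> h ` V. fst x = i}"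
      by (auto simp: colour_class_def)
    also have "\<dots> = {i} \<times> {..<s}"
      using h that by (auto simp: bij_betw_def)
    finally have "bij_betw h (colour_class V (fst \<circ> h) i) ({i} \<times> {..<s})"
      using h by (auto simp: bij_betw_def colour_class_def intro: inj_on_subset)
    then show ?thesis
      by (simp add: bij_betw_same_card)
  qed
  moreover have "(fst \<circ> h) ` V \<subseteq> C"
    using bij_betwE[OF h] by (fastforce simp: mem_Times_iff)
  ultimately show ?thesis by blast
qed

theorem hajnal_szemeredi:
  fixes V :: "'a set" and C :: "'c set"
  assumes "finite V" "finite C" "symp E" "irreflp E"
    and "\<And>v. v \<in> V \<Longrightarrow> deg E V v < card C" and "card V = card C * s"
  shows "\<exists>f. equitable V E C s f"
  using assms
proof (induction "card {(x, y) \<in> V \<times> V. E x y}" arbitrary: V E C rule: less_induct)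
  case less
  have fin: "finite {(x, y) \<in> V \<times> V. E x y}"
    by (rule finite_subset[of _ "V \<times> V"]) (use less.prems(1) in auto)
  show ?case
  proof (cases "\<exists>u\<in>V. \<exists>w\<in>V. E u w")
    case False
    then show ?thesis
      using equipartition_exists[OF less.prems(1,2,6)] by (auto simp: equitable_def colouring_def)
  next
    case True
    then obtain u w where uw: "u \<in> V" "w \<in> V" "E u w" by blast
    \<comment> \<open>At least the edge between \<open>u\<close> and \<open>w\<close> disappears,
      and a proper colouring for \<open>E'\<close> can violate \<open>E\<close> only at
      \<open>u\<close>.\<close>
    define E' where "E' x y \<longleftrightarrow> E x y \<and> x \<noteq> u \<and> y \<noteq> u" for x y
    have "\<exists>f :: 'a \<Rightarrow> 'c. equitable V E' C s f"
    proof (rule less.hyps)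
      show "card {(x, y) \<in> V \<times> V. E' x y} < card {(x, y) \<in> V \<times> V. E x y}"
        using uw fin by (intro psubset_card_mono) (auto simp: E'_def)
      show "symp E'" "irreflp E'"
        using less.prems(3,4) by (auto simp: E'_def symp_def irreflp_def)
      show "deg E' V v < card C" if "v \<in> V" for v
      proof -
        have "deg E' V v \<le> deg E V v"
          unfolding deg_def using less.prems(1) by (intro card_mono) (auto simp: E'_def)
        then show ?thesis
          using less.prems(5)[OF that] by simp
      qed
    qed (use less.prems in auto)
    then obtain f where f: "equitable V E' C s f" by blast
    obtain W where W: "W \<in> C" "\<And>v. v \<in> V \<Longrightarrow> f v = W \<Longrightarrow> \<not> E u v"
      using free_colour[OF less.prems(1,2) less.prems(5)[OF uw(1)], of f] by blast
    have "f u \<in> C"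
      using f uw by (auto simp: equitable_def colouring_def)
    moreover have "colouring V E C (f(u := W))"
      using f W less.prems(3,4) unfolding equitable_def colouring_def
      by (auto simp: E'_def irreflp_def dest: sympD)
    moreover have "card (colour_class V (f(u := W)) i) + of_bool (i = f u) = s + of_bool (i = W)"
      if "i \<in> C" for i
      using card_class_upd[OF less.prems(1) uw(1), of f W i] f that by (simp add: equitable_def)
    \<comment> \<open>\<open>W = f u\<close> is possible; the two defects then cancel.\<close>
    ultimately have "nearly_equitable V E C s (f(u := W)) W (f u)"
      using W by (simp add: nearly_equitable_def)
    show ?thesis
    proof (rule equitable_if_nearly_equitable)
      show "nearly_equitable V E C s (f(u := W)) W (f u)" by fact
      fix V' C' x y
      assume sub: "V' \<subseteq> V" "C' \<subseteq> C" and xy: "x \<in> V - V'" "y \<in> V - V'" "E x y"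
        and rest: "card V' = card C' * s" "\<And>w. w \<in> V' \<Longrightarrow> deg E V' w < card C'"
      show "\<exists>g :: 'a \<Rightarrow> 'c. equitable V' E C' s g"
      proof (rule less.hyps)
        show "card {(x, y) \<in> V' \<times> V'. E x y} < card {(x, y) \<in> V \<times> V. E x y}"
          using sub xy fin by (intro psubset_card_mono) auto
      qed (use sub rest less.prems in \<open>auto intro: finite_subset\<close>)
    qed (use less.prems in auto)
  qed
qed

subsection \<open>Factors into complete graphs\<close>

lemma isomorphic_complete_graph:
  assumes "bij_betw g A B"
  shows "isomorphic (complete_graph A) (complete_graph B)"
proof -
  have inj: "inj_on g A" and B: "g ` A = B"
    using assms by (auto simp: bij_betw_def)
  have "{e. e \<subseteq> B \<and> card e = 2} \<subseteq> (`) g ` {e. e \<subseteq> A \<and> card e = 2}"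
  proof
    fix e assume e: "e \<in> {e. e \<subseteq> B \<and> card e = 2}"
    then obtain d where "d \<subseteq> A" "e = g ` d"
      using B by (auto simp: subset_image_iff)
    then show "e \<in> (`) g ` {e. e \<subseteq> A \<and> card e = 2}"
      using e card_image[of g d] inj_on_subset[OF inj] by auto
  qed
  moreover have "(`) g ` {e. e \<subseteq> A \<and> card e = 2} \<subseteq> {e. e \<subseteq> B \<and> card e = 2}"
  proof
    fix e assume "e \<in> (`) g ` {e. e \<subseteq> A \<and> card e = 2}"
    then obtain d where "d \<subseteq> A" "card d = 2" "e = g ` d" by auto
    then show "e \<in> {e. e \<subseteq> B \<and> card e = 2}"
      using B card_image[OF inj_on_subset[OF inj, of d]] by auto
  qed
  ultimately show ?thesis
    using assms by (auto simp: isomorphic_def complete_graph_def intro!: exI[of _ g])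
qed

lemma isomorphic_complete_graph_verts:
  assumes "isomorphic (complete_graph A) D"
  shows "card (verts D) = card A" "finite A \<Longrightarrow> finite (verts D)" "\<And>e. e \<in> edges D \<Longrightarrow> e \<subseteq> verts D"
proof -
  obtain g where g: "bij_betw g A (verts D)"
    "edges D = (`) g ` {e. e \<subseteq> A \<and> card e = 2}"
    using assms by (auto simp: isomorphic_def complete_graph_def)
  show "card (verts D) = card A"
    using bij_betw_same_card[OF g(1)] by simp
  show "finite A \<Longrightarrow> finite (verts D)"
    using bij_betw_finite[OF g(1)] by simp
  show "\<And>e. e \<in> edges D \<Longrightarrow> e \<subseteq> verts D"
    unfolding bij_betw_imp_surj_on[OF g(1), symmetric] g(2) by (auto intro: imageI)
qed

text \<open>The copies are disjoint, so every factor edge at \<open>v\<close> lies in the one copy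
  containing \<open>v\<close>, which has \<open>k - 1\<close> further vertices.\<close>

lemma factor_deg:
  assumes "is_factor (complete_graph {..<k}) G F" "finite (verts G)" "v \<in> verts G"
  shows "card {w\<in>verts G. v \<noteq> w \<and> {v, w} \<in> edges F} \<le> k - 1"
proof -
  obtain \<C> where iso: "\<And>D. D \<in> \<C> \<Longrightarrow> isomorphic (complete_graph {..<k}) D"
    and disj: "pairwise (\<lambda>C D. disjnt (verts C) (verts D)) \<C>"
    and F: "F = graph_Union \<C>" "verts F = verts G"
    using assms(1) by (auto simp: is_factor_def)
  obtain D where D: "D \<in> \<C>" "v \<in> verts D"
    using F assms(3) by (auto simp: graph_Union_def)
  note D_verts = isomorphic_complete_graph_verts[OF iso[OF D(1)]]
  have "{w\<in>verts G. v \<noteq> w \<and> {v, w} \<in> edges F} \<subseteq> verts D - {v}"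
  proof
    fix w assume w: "w \<in> {w\<in>verts G. v \<noteq> w \<and> {v, w} \<in> edges F}"
    then obtain D' where D': "D' \<in> \<C>" "{v, w} \<in> edges D'"
      using F by (auto simp: graph_Union_def)
    then have "{v, w} \<subseteq> verts D'"
      using isomorphic_complete_graph_verts(3)[OF iso] by blast
    moreover from this have "D' = D"
      using D D' disj by (auto simp: pairwise_def disjnt_def)
    ultimately show "w \<in> verts D - {v}"
      using w by auto
  qed
  then have "card {w\<in>verts G. v \<noteq> w \<and> {v, w} \<in> edges F} \<le> card (verts D - {v})"
    using D_verts(2) by (intro card_mono) auto
  also have "\<dots> = k - 1"
    using D D_verts by simp
  finally show ?thesis .
qed

text \<open>Makes the number of remaining edges drop in each greedy step. A nonempty vertex set
  forces at least one copy, and \<open>2 \<le> k\<close> gives it an edge; over an empty vertex set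
  the empty factor could be appended forever.\<close>

lemma factor_edges:
  fixes k :: nat
  assumes "is_factor (complete_graph {..<k}) G F" "2 \<le> k" "verts G \<noteq> {}"
  shows "edges F \<noteq> {}" "edges F \<subseteq> edges G"
proof -
  obtain \<C> where iso: "\<And>D. D \<in> \<C> \<Longrightarrow> isomorphic (complete_graph {..<k}) D"
    and sub: "\<And>D. D \<in> \<C> \<Longrightarrow> subgraph D G"
    and F: "F = graph_Union \<C>" "verts F = verts G"
    using assms(1) by (auto simp: is_factor_def)
  obtain D where D: "D \<in> \<C>"
    using F assms(3) by (auto simp: graph_Union_def)
  obtain g where "edges D = (`) g ` {e. e \<subseteq> {..<k} \<and> card e = 2}"
    using iso[OF D] by (auto simp: isomorphic_def complete_graph_def)
  moreover have "{0, 1} \<in> {e. e \<subseteq> {..<k} \<and> card e = 2}"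
    using assms(2) by auto
  ultimately have "edges D \<noteq> {}"
    by blast
  then show "edges F \<noteq> {}"
    using D F by (auto simp: graph_Union_def)
  show "edges F \<subseteq> edges G"
    using F(1) sub by (simp add: graph_Union_def subgraph_def UN_least)
qed

text \<open>Two vertices of one class have not met, so each class spans a complete subgraph of the
  feasibility graph. The \<open>M\<close> colours become the groups of the new round.\<close>

lemma extendable_if_equitable:
  fixes k M :: nat
  assumes "equitable V (\<lambda>x y. x \<noteq> y \<and> {x, y} \<in> (\<Union>F\<in>set Hs. edges F)) {..<M} k f" "finite V"
  shows "extendable (complete_graph {..<k}) V Hs"
proof -
  let ?G = "feasibility_graph V Hs"
  let ?\<C> = "(\<lambda>i. complete_graph (colour_class V f i)) ` {..<M}"
  have "f ` V \<subseteq> {..<M}"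
    and proper: "\<And>x y. x \<in> V \<Longrightarrow> y \<in> V \<Longrightarrow> f x = f y \<Longrightarrow> x \<noteq> y \<Longrightarrow> {x, y} \<notin> (\<Union>F\<in>set Hs. edges F)"
    using assms(1) by (auto simp: equitable_def colouring_def)
  have "subgraph (complete_graph (colour_class V f i)) ?G" for i
  proof -
    have "e \<in> edges ?G" if e: "e \<subseteq> colour_class V f i" "card e = 2" for e
    proof -
      obtain x y where "e = {x, y}" "x \<noteq> y"
        using e(2) by (auto simp: card_2_iff)
      then show ?thesis
        using e proper[of x y] by (auto simp: feasibility_graph_def complete_graph_def colour_class_def)
    qed
    then show ?thesis
      by (auto simp: subgraph_def complete_graph_def feasibility_graph_def colour_class_def)
  qed
  moreover have "isomorphic (complete_graph {..<k}) (complete_graph (colour_class V f i))" if "i < M" for i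
  proof -
    have "card (colour_class V f i) = k"
      using assms(1) that by (simp add: equitable_def)
    moreover have "finite (colour_class V f i)"
      using assms(2) by (simp add: colour_class_def)
    ultimately obtain g where "bij_betw g {..<k} (colour_class V f i)"
      using ex_bij_betw_nat_finite[of "colour_class V f i"] by (auto simp: atLeast0LessThan)
    then show ?thesis
      by (rule isomorphic_complete_graph)
  qed
  moreover have "pairwise (\<lambda>C D. disjnt (verts C) (verts D)) ?\<C>"
    by (auto simp: pairwise_def disjnt_def complete_graph_def colour_class_def)
  moreover have "verts (graph_Union ?\<C>) = verts ?G"
    using \<open>f ` V \<subseteq> {..<M}\<close>
    by (auto simp: graph_Union_def complete_graph_def colour_class_def feasibility_graph_def)
  ultimately show ?thesis
    unfolding extendable_def is_factor_def by (intro exI[of _ "graph_Union ?\<C>"] exI[of _ ?\<C>]) auto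
qed

section \<open>Counting rounds and termination of the greedy algorithm\<close>

lemma extendable_if_few_rounds:
  assumes "tournament (complete_graph {..<k}) V Hs" "finite V" "card V = M * k"
    and "length Hs * (k - 1) < M"
  shows "extendable (complete_graph {..<k}) V Hs"
proof -
  let ?E = "\<lambda>x y. x \<noteq> y \<and> {x, y} \<in> (\<Union>F\<in>set Hs. edges F)"
  have "deg ?E V v < card {..<M}" if v: "v \<in> V" for v
  proof -
    let ?N = "\<lambda>F. {w\<in>V. v \<noteq> w \<and> {v, w} \<in> edges F}"
    \<comment> \<open>The vertices that \<open>v\<close> has met are collected round by round, at
      most \<open>k - 1\<close> in each.\<close>
    have "deg ?E V v = card (\<Union>F\<in>set Hs. ?N F)"
      unfolding deg_def by (rule arg_cong[where f = card]) auto
    also have "\<dots> \<le> (\<Sum>F\<in>set Hs. card (?N F))"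
      by (rule card_UN_le) simp
    also have "\<dots> \<le> (\<Sum>F\<in>set Hs. k - 1)"
    proof (rule sum_mono)
      fix F assume "F \<in> set Hs"
      then have "is_factor (complete_graph {..<k}) (complete_graph V) F"
        using assms(1) by (simp add: tournament_def)
      from factor_deg[OF this, of v] show "card (?N F) \<le> k - 1"
        using assms(2) v by (simp add: complete_graph_def)
    qed
    also have "\<dots> \<le> length Hs * (k - 1)"
      by (simp add: card_length)
    finally show ?thesis
      using assms(4) by simp
  qed
  moreover have "symp ?E" "irreflp ?E"
    by (auto simp: symp_def irreflp_def insert_commute)
  ultimately have "\<exists>f. equitable V ?E {..<M} k f"
    using assms(2,3) by (intro hajnal_szemeredi) auto
  then show ?thesis
    using extendable_if_equitable assms(2) by blast
qed

lemma greedy_terminates_complete_graph: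
  fixes k :: nat and V :: "'a set"
  assumes "2 \<le> k" "finite V" "V \<noteq> {}"
  shows "greedy_terminates (complete_graph {..<k}) V"
  unfolding greedy_terminates_def
proof
  assume "\<exists>S :: nat \<Rightarrow> 'a graph list. S 0 = [] \<and>
    (\<forall>i. greedy_step (complete_graph {..<k}) V (S i) (S (Suc i)))"
  then obtain S where step: "\<And>i. greedy_step (complete_graph {..<k}) V (S i) (S (Suc i))"
    by blast
  define c where "c i = card (edges (feasibility_graph V (S i)))" for i
  have "c (Suc i) < c i" for i
  proof -
    obtain F where F: "is_factor (complete_graph {..<k}) (feasibility_graph V (S i)) F"
      "S (Suc i) = S i @ [F]"
      using step[of i] by (auto simp: greedy_step_def)
    have "edges F \<noteq> {}" "edges F \<subseteq> edges (feasibility_graph V (S i))"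
      using factor_edges[OF F(1)] assms by (auto simp: feasibility_graph_def)
    moreover have "edges (feasibility_graph V (S (Suc i))) = edges (feasibility_graph V (S i)) - edges F"
      unfolding F(2) by (auto simp: feasibility_graph_def)
    moreover have "finite (edges (feasibility_graph V (S i)))"
      using assms(2) by (auto simp: feasibility_graph_def complete_graph_def)
    ultimately show ?thesis
      unfolding c_def by (intro psubset_card_mono) auto
  qed
  then have "c i + i \<le> c 0" for i
    by (induction i) (auto simp: Suc_le_eq elim: order.strict_trans2[rotated] dest: less_le_trans)
  from this[of "Suc (c 0)"] show False by simp
qed

lemma tournament_if_greedy:
  assumes "(greedy_step H V)\<^sup>*\<^sup>* [] Hs"
  shows "tournament H V Hs"
  using assms
proof (induction rule: rtranclp_induct)
  case base
  show ?case by (simp add: tournament_def)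
next
  case (step Hs Hs')
  then show ?case
    using tournament_append by (auto simp: greedy_step_def)
qed

theorem theorem1:
  fixes k n :: nat and V :: "'a set"
  assumes "k \<ge> 2" and "n > 0" and "k dvd n" and "card V = n"
  shows "(\<forall>Hs. tournament (complete_graph {..<k}) V Hs \<and> \<not> extendable (complete_graph {..<k}) V Hs \<longrightarrow>
            int (length Hs) \<ge> \<lfloor>real n / (real k * (real k - 1))\<rfloor>)
       \<and> greedy_terminates (complete_graph {..<k}) V
       \<and> (\<forall>Hs. greedy_output (complete_graph {..<k}) V Hs \<longrightarrow>
            tournament (complete_graph {..<k}) V Hs \<and>
            int (length Hs) \<ge> \<lfloor>real n / (real k * (real k - 1))\<rfloor>)"
proof -
  \<comment> \<open>An infinite set has \<open>card\<close> 0, so \<open>n > 0\<close> yields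
    finiteness as well.\<close>
  have V: "finite V" "V \<noteq> {}"
    using assms(2,4) card_gt_0_iff[of V] by auto
  obtain M where M: "n = M * k"
    using assms(3) by (metis dvdE mult.commute)
  have bound: "\<lfloor>real n / (real k * (real k - 1))\<rfloor> \<le> int (length Hs)"
    if Hs: "tournament (complete_graph {..<k}) V Hs" "\<not> extendable (complete_graph {..<k}) V Hs" for Hs
  proof (rule ccontr)
    assume "\<not> ?thesis"
    then have "int (length Hs) + 1 \<le> \<lfloor>real n / (real k * (real k - 1))\<rfloor>"
      by linarith
    then have "real (length Hs) + 1 \<le> real n / (real k * (real k - 1))"
      by (simp add: le_floor_iff)
    also have "\<dots> = real M / real (k - 1)"
      using assms(1) by (simp add: M of_nat_diff)
    finally have "(real (length Hs) + 1) * real (k - 1) \<le> real M"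
      using assms(1) by (simp add: pos_le_divide_eq)
    then have "(length Hs + 1) * (k - 1) \<le> M"
      by (metis of_nat_1 of_nat_add of_nat_le_iff of_nat_mult)
    \<comment> \<open>Dropping one round subtracts \<open>k - 1 \<ge> 1\<close>, which makes the
      inequality strict.\<close>
    then have "length Hs * (k - 1) < M"
      using assms(1) by simp
    then show False
      using extendable_if_few_rounds Hs V(1) assms(4) M by blast
  qed
  moreover have "\<not> extendable (complete_graph {..<k}) V Hs"
    if "greedy_output (complete_graph {..<k}) V Hs" for Hs
    using that by (auto simp: greedy_output_def greedy_step_def extendable_def)
  moreover have "tournament (complete_graph {..<k}) V Hs"
    if "greedy_output (complete_graph {..<k}) V Hs" for Hs
    using that tournament_if_greedy by (auto simp: greedy_output_def)
  ultimately show ?thesis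
    using greedy_terminates_complete_graph[OF assms(1) V]
    by blast
qed

end
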